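(* Let $p\ge 1$ be an integer and let $R(z)=P(z)/Q(z)$ with $$P(z)=\sum_{j=0}^{p-1}b_jz^{2(p-1-j)},\qquad Q(z)=\sum_{j=0}^{p}a_jz^{2(p-j)},$$ where all $a_j,b_j$ are positive real numbers and $a_0=a_p=1$. Put $a_j=0$ for $j>p$, and $b_j=0$ for $j>p-1$ and for $j<0$. Define $$d_{p+1-j}=\sum_{k=0}^{j}a_{p-k}a_{j-k}\quad(0\le j\le p-1),\qquad d_1=\frac12\sum_{k=0}^{p}a_{p-k}^2,$$ $$c_j=\sum_{k=0}^{2p-1}a_k\,b_{p-1-j+k}\quad(0\le j\le 2p-1),$$ $$\alpha_p(i)=\begin{cases}2^{2i-1}\displaystyle\sum_{k=1}^{p+1-i}\frac{k+i-1}{i}\binom{k+2i-2}{k-1}d_{k+i}&\text{if }1\le i\le p,\\[2mm] 1+\displaystyle\sum_{k=1}^{p}d_k&\text{if }i=0.\end{cases}$$ Let $a_0^+=a_p^+=1$, $$a_i^+=\frac{\alpha_p(i)}{2^{2i-1}\,Q(1)^{2(1-i/p)}}\quad(1\le i\le p-1),$$ $$b_i^+=Q(1)^{2i/p+1/p-2}\sum_{k=0}^{p-1-i}(c_k+c_{2p-1-k})\binom{p-1-k+i}{2i}\quad(0\le i\le p-1),$$ and define the polynomials $$P^+(z)=\sum_{i=0}^{p-1}b_i^+z^{2(p-1-i)},\qquad Q^+(z)=\sum_{i=0}^{p}a_i^+z^{2(p-i)}.$$ Then $$\int_0^\infty\frac{P(z)}{Q(z)}\,dz=\int_0^\infty\frac{P^+(z)}{Q^+(z)}\,dz.$$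 *)

theory Defs
  imports "HOL-Analysis.Analysis" "HOL-Computational_Algebra.Polynomial"
begin

text \<open>Coefficients are listed from the leading term downwards:
  \<open>even_poly n u\<close> is \<open>u\<^sub>0 z\<^sup>2\<^sup>n + u\<^sub>1 z\<^sup>2\<^sup>n\<^sup>-\<^sup>2 + \<dots> + u\<^sub>n\<close>.\<close>

definition even_poly :: "nat \<Rightarrow> (nat \<Rightarrow> real) \<Rightarrow> real poly" where
  "even_poly n u = (\<Sum>j=0..n. monom (u j) (2 * (n - j)))"

text \<open>The convention that coefficients outside their range vanish. Integer indices are
  needed because the subscript \<open>p - 1 - j + k\<close> in \<open>c_coeff\<close> may be negative.\<close>

definition zero_ext :: "nat \<Rightarrow> (nat \<Rightarrow> real) \<Rightarrow> int \<Rightarrow> real" where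
  "zero_ext n u j = (if 0 \<le> j \<and> j \<le> int n then u (nat j) else 0)"

text \<open>Meaningful for \<open>1 \<le> m \<le> p + 1\<close>; the second case is the formula for
  \<open>d\<^sub>p\<^sub>+\<^sub>1\<^sub>-\<^sub>j\<close> with \<open>j = p + 1 - m\<close>.\<close>

definition d_coeff :: "nat \<Rightarrow> (nat \<Rightarrow> real) \<Rightarrow> nat \<Rightarrow> real" where
  "d_coeff p a m =
     (if m = 1 then 1 / 2 * (\<Sum>k=0..p. (a (p - k))\<^sup>2)
      else (\<Sum>k=0..p + 1 - m. a (p - k) * a (p + 1 - m - k)))"

definition c_coeff :: "nat \<Rightarrow> (nat \<Rightarrow> real) \<Rightarrow> (nat \<Rightarrow> real) \<Rightarrow> nat \<Rightarrow> real" where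
  "c_coeff p a b j =
     (\<Sum>k=0..2 * p - 1. zero_ext p a (int k) *
        zero_ext (p - 1) b (int p - 1 - int j + int k))"

definition alpha :: "nat \<Rightarrow> (nat \<Rightarrow> real) \<Rightarrow> nat \<Rightarrow> real" where
  "alpha p a i =
     (if i = 0 then 1 + (\<Sum>k=1..p. d_coeff p a k)
      else 2 ^ (2 * i - 1) *
        (\<Sum>k=1..p + 1 - i. (real k + real i - 1) / real i *
            real ((k + 2 * i - 2) choose (k - 1)) * d_coeff p a (k + i)))"

definition a_plus :: "nat \<Rightarrow> (nat \<Rightarrow> real) \<Rightarrow> nat \<Rightarrow> real" where
  "a_plus p a i =
     (if i = 0 \<or> i = p then 1
      else alpha p a i /
        (2 ^ (2 * i - 1) * poly (even_poly p a) 1 powr (2 * (1 - real i / real p))))"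

definition b_plus :: "nat \<Rightarrow> (nat \<Rightarrow> real) \<Rightarrow> (nat \<Rightarrow> real) \<Rightarrow> nat \<Rightarrow> real" where
  "b_plus p a b i =
     poly (even_poly p a) 1 powr (2 * real i / real p + 1 / real p - 2) *
     (\<Sum>k=0..p - 1 - i. (c_coeff p a b k + c_coeff p a b (2 * p - 1 - k)) *
        real ((p - 1 - k + i) choose (2 * i)))"

end

theory Submission
  imports Defs
begin

text \<open>Folding the half-line onto \<open>[0, 1]\<close> by \<open>z \<mapsto> 1/z\<close> turns the integrand into
  \<open>N/(Q Q')\<close>, where \<open>P'\<close>, \<open>Q'\<close> are the reversed polynomials and \<open>N = P Q' + P' Q\<close>.
  After division by a suitable power of \<open>z\<close>, both \<open>Q Q'\<close> and \<open>N/(z\<^sup>2 + 1)\<close> are invariant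
  under \<open>z \<mapsto> 1/z\<close>, hence polynomials in \<open>(1/z - z)\<^sup>2\<close>; the Chebyshev type sums
  \<open>\<Sum>\<^sub>i binom(m + i, 2i) (1/z - z)\<^sup>2\<^sup>i\<close> make their coefficients explicit.
  The Landen substitution \<open>y = c/(1/z - z)\<close>, a bijection from \<open>(0, 1)\<close> to \<open>(0, \<infinity>)\<close>,
  then carries the folded integrand to \<open>P\<^sup>+/Q\<^sup>+\<close>;
  the scale \<open>c = Q(1)\<^sup>1\<^sup>/\<^sup>p\<close> is the one that makes \<open>Q\<^sup>+\<close> monic with constant term 1.\<close>

section \<open>Changes of variables on the half-line\<close>

text \<open>Splits at 1 and pulls \<open>{1..}\<close> back to \<open>{0<..1}\<close> along
  \<open>1 / z\<close>. The pull-back is a separate function \<open>h\<close> because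
  \<open>f (1 / z) / z\<^sup>2\<close> takes a mere default value at 0; \<open>h\<close> is its
  continuous extension, so integrability on the closed interval is immediate.\<close>

lemma has_integral_fold:
  fixes f h :: "real \<Rightarrow> real"
  assumes f: "continuous_on {0..1} f" and h: "continuous_on {0..1} h"
    and eq: "\<And>z. 0 < z \<Longrightarrow> z \<le> 1 \<Longrightarrow> h z = f (1 / z) / z\<^sup>2"
  shows "(f has_integral integral {0..1} (\<lambda>z. f z + h z)) {0..}"
proof -
  have h01: "h absolutely_integrable_on {0..1}"
    by (rule absolutely_integrable_continuous_real[OF h])
  have null: "negligible {x \<in> {0..1} - {0<..1}. h x \<noteq> 0}"
    "negligible {x \<in> {0<..1} - {0..1}. h x \<noteq> 0}"
    by (rule negligible_subset[of "{0}"], auto)+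
  have "h absolutely_integrable_on {0<..1}"
    by (rule absolutely_integrable_spike_set[OF h01 null])
  moreover have "integral {0<..1} h = integral {0..1} h"
    using integral_spike_set[OF null] by simp
  moreover have pull: "\<bar>- 1 / z\<^sup>2\<bar> * f (1 / z) = h z" if "z \<in> {0<..1}" for z
    using that by (simp add: eq)
  ultimately have "(\<lambda>z. \<bar>- 1 / z\<^sup>2\<bar> * f (1 / z)) absolutely_integrable_on {0<..1} \<and>
      integral {0<..1} (\<lambda>z. \<bar>- 1 / z\<^sup>2\<bar> * f (1 / z)) = integral {0..1} h"
    by (smt (verit, best) integral_cong set_integrable_cong)
  moreover have "((\<lambda>z. 1 / z) has_field_derivative - 1 / z\<^sup>2) (at z within {0<..1})"
    if "z \<in> {0<..1}" for z :: real
    using that by (auto intro!: derivative_eq_intros simp: power2_eq_square)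
  moreover have "inj_on (\<lambda>z::real. 1 / z) {0<..1}"
    by (auto simp: inj_on_def)
  moreover have "(\<lambda>z::real. 1 / z) ` {0<..1} = {1..}"
  proof (intro set_eqI iffI)
    show "y \<in> (\<lambda>z. 1 / z) ` {0<..1}" if "y \<in> {1..}" for y :: real
      using that by (intro image_eqI[of _ _ "1 / y"]) auto
  qed auto
  ultimately have "f absolutely_integrable_on {1..} \<and> integral {1..} f = integral {0..1} h"
    using has_absolute_integral_change_of_variables_1'[of "{0<..1}" "\<lambda>z. 1 / z" "\<lambda>z. - 1 / z\<^sup>2" f
        "integral {0..1} h"] by simp
  then have f2: "(f has_integral integral {0..1} h) {1..}"
    by (metis absolutely_integrable_on_def has_integral_integral)
  have f1: "(f has_integral integral {0..1} f) {0..1}"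
    using f integrable_continuous_real by blast
  have "(f has_integral integral {0..1} f + integral {0..1} h) ({0..1} \<union> {1..})"
    by (rule has_integral_Un[OF f1 f2]) simp
  moreover have "{0..1} \<union> {1..} = {0::real..}" by auto
  ultimately show ?thesis
    using integral_add[of f "{0..1}" h] f h by (simp add: integrable_continuous_real)
qed

text \<open>The factor before \<open>G\<close> is the derivative of \<open>c / (1 / z - z)\<close>.
  \<open>F\<close> is continuous up to both endpoints, where the substitution itself breaks down,
  and absolute integrability of \<open>G\<close> on the half-line is inherited from
  \<open>F\<close>.\<close>

lemma has_integral_Landen_substitution:
  fixes F G :: "real \<Rightarrow> real"
  assumes c: "c > 0" and F: "continuous_on {0..1} F"
    and eq: "\<And>z. 0 < z \<Longrightarrow> z < 1 \<Longrightarrow>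
      F z = c * (1 + 1 / z\<^sup>2) / (1 / z - z)\<^sup>2 * G (c / (1 / z - z))"
  shows "(G has_integral integral {0..1} F) {0..}"
proof -
  define g where "g z = c / (1 / z - z)" for z :: real
  define g' where "g' z = c * (1 + 1 / z\<^sup>2) / (1 / z - z)\<^sup>2" for z :: real
  have pos: "1 / z - z > 0" if "z \<in> {0<..<1}" for z :: real
    using that less_divide_eq_1_pos[of z 1] by (smt (verit) greaterThanLessThan_iff)
  have "F absolutely_integrable_on {0<..<1}"
    using absolutely_integrable_continuous_real[OF F] absolutely_integrable_on_Icc_iff_Ioo by blast
  moreover have "integral {0<..<1} F = integral {0..1} F"
    by (rule integral_open_interval_real[symmetric])
  moreover have pull: "\<bar>g' z\<bar> * G (g z) = F z" if "z \<in> {0<..<1}" for z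
  proof -
    have "\<bar>g' z\<bar> = g' z" using c by (simp add: g'_def)
    moreover have "F z = g' z * G (g z)"
      unfolding g'_def g_def using that by (intro eq) auto
    ultimately show ?thesis by simp
  qed
  ultimately have "(\<lambda>z. \<bar>g' z\<bar> * G (g z)) absolutely_integrable_on {0<..<1} \<and>
      integral {0<..<1} (\<lambda>z. \<bar>g' z\<bar> * G (g z)) = integral {0..1} F"
    by (smt (verit, best) integral_cong set_integrable_cong)
  \<comment> \<open>Clears the signs that differentiating the quotient \<open>g\<close> produces,
    giving the form of \<open>g'\<close>.\<close>
  moreover have neg: "- (c * (- A - 1) / B) = c * (1 + A) / B" for A B
  proof -
    have "- (c * (- A - 1)) = c * (1 + A)" by algebra
    then show ?thesis by (metis minus_divide_left)
  qed
  moreover have "(g has_field_derivative g' z) (at z within {0<..<1})" if "z \<in> {0<..<1}" for z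
    unfolding g_def g'_def using pos[OF that] that
    by (auto intro!: derivative_eq_intros simp: power2_eq_square neg)
  moreover have "inj_on g {0<..<1}"
  proof (rule inj_onI)
    fix y z assume yz: "y \<in> {0<..<1}" "z \<in> {0<..<1}" and "g y = g z"
    then have "1 / y - y = 1 / z - z"
      using c pos[of y] pos[of z] by (simp add: g_def frac_eq_eq)
    \<comment> \<open>Hence \<open>1 / t - t\<close> is strictly decreasing for positive
      \<open>t\<close>, which yields injectivity.\<close>
    moreover have "1 / t < 1 / s" if "0 < s" "s < t" for s t :: real
      using that by (simp add: frac_less2)
    ultimately show "y = z"
      using yz by (smt (verit, ccfv_SIG) greaterThanLessThan_iff)
  qed
  moreover have "g ` {0<..<1} = {0<..}"
  proof (intro set_eqI iffI)
    fix y :: real assume y: "y \<in> {0<..}"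
    define u where "u = c / y"
    \<comment> \<open>The positive root of \<open>z\<^sup>2 + u * z - 1 = 0\<close>, which is
      \<open>1 / z - z = u\<close> cleared of fractions. In this rationalised form
      \<open>z < 1\<close> follows at once from \<open>sqrt (u\<^sup>2 + 4) > 2\<close>.\<close>
    define z where "z = 2 / (u + sqrt (u\<^sup>2 + 4))"
    have u: "u > 0" using y c by (simp add: u_def)
    have s: "sqrt (u\<^sup>2 + 4) > 2" by (rule real_less_rsqrt) (use u in simp)
    have z: "z \<in> {0<..<1}" using u s by (simp add: z_def)
    have "(sqrt (u\<^sup>2 + 4) + u) * (sqrt (u\<^sup>2 + 4) - u) = 4"
      by (simp add: algebra_simps flip: power2_eq_square)
    then have "z = (sqrt (u\<^sup>2 + 4) - u) / 2"
      using u s by (simp add: z_def field_simps)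
    moreover have "1 / z = (sqrt (u\<^sup>2 + 4) + u) / 2" by (simp add: z_def add.commute)
    ultimately have "1 / z - z = u" by (simp add: field_simps)
    then have "g z = y" using c y by (simp add: g_def u_def)
    then show "y \<in> g ` {0<..<1}" using z by auto
  qed (use pos c in \<open>auto simp: g_def\<close>)
  ultimately have "G absolutely_integrable_on {0<..} \<and> integral {0<..} G = integral {0..1} F"
    using has_absolute_integral_change_of_variables_1'[of "{0<..<1}" g g' G "integral {0..1} F"]
    by simp
  then have "(G has_integral integral {0..1} F) {0<..}"
    by (metis absolutely_integrable_on_def has_integral_integral)
  moreover have "(G has_integral I) {0<..} \<longleftrightarrow> (G has_integral I) {0..}" for I
    by (rule has_integral_spike_set_eq; rule negligible_subset[of "{0}"]) auto
  ultimately show ?thesis by blast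
qed

section \<open>Chebyshev type sums and diagonal summation\<close>

text \<open>The second sum only serves to make the induction on \<open>m\<close> go through: by Pascal's rule the
  two families satisfy a coupled first-order recurrence.\<close>

lemma Chebyshev_sums:
  fixes z v :: real
  assumes zv: "z * v = 1" and "m \<le> N"
  shows "(z + v) * (\<Sum>i\<le>N. real ((m + i) choose (2 * i)) * ((v - z)\<^sup>2) ^ i)
      = z ^ (2 * m + 1) + v ^ (2 * m + 1)
    \<and> (z + v) * (z - v) * (\<Sum>i<N. real ((m + i) choose (2 * i + 1)) * ((v - z)\<^sup>2) ^ i)
      = z ^ (2 * m) - v ^ (2 * m)" (is "_ * ?E m = _ \<and> _ * ?O m = _")
  using \<open>m \<le> N\<close>
proof (induction m)
  case 0
  have "?E 0 = (\<Sum>i\<le>N. if i = 0 then 1 else 0)"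
    by (intro sum.cong) (auto simp: binomial_eq_0)
  then have "?E 0 = 1" by simp
  moreover have "?O 0 = 0"
    by (intro sum.neutral) (auto simp: binomial_eq_0)
  ultimately show ?case by simp
next
  case (Suc m)
  define x where "x = (v - z)\<^sup>2"
  have "?O (Suc m) = (\<Sum>i<N. real ((m + i) choose (2 * i + 1)) * x ^ i) +
      (\<Sum>i<N. real ((m + i) choose (2 * i)) * x ^ i)"
    unfolding x_def[symmetric] sum.distrib[symmetric] by (intro sum.cong) (auto simp: algebra_simps)
  \<comment> \<open>The term \<open>i = N\<close> can be added because \<open>m < N\<close> makes
    its binomial vanish.\<close>
  also have "(\<Sum>i<N. real ((m + i) choose (2 * i)) * x ^ i) =
      (\<Sum>i\<le>N. real ((m + i) choose (2 * i)) * x ^ i)"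
    using Suc.prems by (simp add: lessThan_Suc_atMost[symmetric] binomial_eq_0)
  finally have O: "?O (Suc m) = ?O m + ?E m" by (simp add: x_def)
  have "?E (Suc m) = 1 + (\<Sum>i<N. real ((Suc m + Suc i) choose (2 * Suc i)) * x ^ Suc i)"
    by (simp add: x_def sum.atMost_shift)
  also have "(\<Sum>i<N. real ((Suc m + Suc i) choose (2 * Suc i)) * x ^ Suc i) =
      (\<Sum>i<N. real ((m + Suc i) choose (2 * Suc i)) * x ^ Suc i) +
      x * (\<Sum>i<N. real ((Suc m + i) choose (2 * i + 1)) * x ^ i)"
    unfolding sum_distrib_left sum.distrib[symmetric] by (intro sum.cong) (auto simp: algebra_simps)
  also have "1 + (\<dots>) = ?E m + x * ?O (Suc m)"
    by (simp add: x_def sum.atMost_shift)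
  finally have E: "?E (Suc m) = ?E m + x * ?O (Suc m)" .
  have IH: "(z + v) * ?E m = z ^ (2 * m + 1) + v ^ (2 * m + 1)"
    "(z + v) * (z - v) * ?O m = z ^ (2 * m) - v ^ (2 * m)"
    using Suc by auto
  \<comment> \<open>The mixed products collapse by \<open>z * v = 1\<close>. The identity serves
    twice: with \<open>Y\<close> an even power of \<open>v\<close> for the second family, with
    \<open>Y\<close> a negated odd power for the first.\<close>
  have cross: "(z - v) * (z * X + v * Y) = z\<^sup>2 * X - v\<^sup>2 * Y - X + Y" for X Y
    using zv by algebra
  have "(z + v) * (z - v) * ?O (Suc m) = z ^ (2 * m) - v ^ (2 * m) + (z - v) * ((z + v) * ?E m)"
    unfolding O IH(2)[symmetric] by (simp add: algebra_simps)
  also have "\<dots> = z ^ (2 * m) - v ^ (2 * m) + (z - v) * (z ^ (2 * m + 1) + v ^ (2 * m + 1))"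
    by (simp only: IH(1))
  also have "\<dots> = z ^ (2 * m + 2) - v ^ (2 * m + 2)"
    using cross[of "z ^ (2 * m)" "v ^ (2 * m)"] by (simp add: power2_eq_square)
  finally have O': "(z + v) * (z - v) * ?O (Suc m) = z ^ (2 * m + 2) - v ^ (2 * m + 2)" .
  have "(z + v) * ?E (Suc m) = (z + v) * ?E m + (z - v) * ((z + v) * (z - v) * ?O (Suc m))"
    unfolding E x_def by (simp add: algebra_simps power2_eq_square)
  also have "\<dots> = z ^ (2 * m + 1) + v ^ (2 * m + 1) + (z - v) * (z ^ (2 * m + 2) - v ^ (2 * m + 2))"
    by (simp only: IH O')
  also have "\<dots> = z ^ (2 * Suc m + 1) + v ^ (2 * Suc m + 1)"
    using cross[of "z ^ (2 * m + 1)" "- (v ^ (2 * m + 1))"] by (simp add: power2_eq_square)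
  finally show ?case using O' by simp
qed

text \<open>Entries of the square are grouped by their distance \<open>m\<close> from the main
  diagonal, each paired with its transpose. The induction step adds a last row and column, which
  contribute the corner and one pair to each \<open>m\<close>.\<close>

lemma sum_square_diagonals:
  fixes h :: "nat \<Rightarrow> nat \<Rightarrow> real"
  shows "(\<Sum>j\<le>n. \<Sum>k\<le>n. h j k) =
    (\<Sum>j\<le>n. h j j) + (\<Sum>m=1..n. \<Sum>j\<le>n - m. h j (j + m) + h (j + m) j)"
proof (induction n)
  case (Suc n)
  have "(\<Sum>m=1..n. \<Sum>j\<le>Suc n - m. h j (j + m) + h (j + m) j) =
    (\<Sum>m=1..n. (\<Sum>j\<le>n - m. h j (j + m) + h (j + m) j) + (h (Suc n - m) (Suc n) + h (Suc n) (Suc n - m)))"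
    by (intro sum.cong) (auto simp: Suc_diff_le)
  moreover have "(\<Sum>m=1..Suc n. h (Suc n - m) (Suc n) + h (Suc n) (Suc n - m)) =
     (\<Sum>j\<le>n. h j (Suc n) + h (Suc n) j)"
    by (rule sum.reindex_bij_witness[of _ "\<lambda>j. Suc n - j" "\<lambda>m. Suc n - m"]) auto
  ultimately show ?case
    using Suc by (simp add: sum.distrib)
qed simp


section \<open>Evaluation and reversal of even polynomials\<close>

lemma poly_even_poly: "poly (even_poly n u) z = (\<Sum>j\<le>n. u j * z ^ (2 * (n - j)))"
  by (simp add: even_poly_def poly_sum poly_monom atLeast0AtMost)

lemma poly_even_poly_rev:
  "poly (even_poly n (\<lambda>j. u (n - j))) z = (\<Sum>j\<le>n. u j * z ^ (2 * j))"
  unfolding poly_even_poly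
  by (rule sum.reindex_bij_witness[of _ "\<lambda>j. n - j" "\<lambda>j. n - j"]) auto

text \<open>Reversing the coefficients gives the reciprocal polynomial. The inverse is a variable
  \<open>v\<close> with \<open>z * v = 1\<close>, so that later identities stay polynomial in
  \<open>z\<close> and \<open>v\<close> and the two can exchange roles.\<close>

lemma poly_even_poly_inverse:
  assumes "z * v = 1"
  shows "v ^ (2 * n) * poly (even_poly n u) z = poly (even_poly n (\<lambda>j. u (n - j))) v"
proof -
  have "v ^ (2 * n) * z ^ (2 * (n - j)) = v ^ (2 * j)" if "j \<le> n" for j
  proof -
    have "2 * n = 2 * j + 2 * (n - j)" using that by simp
    then have "v ^ (2 * n) = v ^ (2 * j) * v ^ (2 * (n - j))" by (metis power_add)
    then show ?thesis using assms by (simp add: mult.commute flip: power_mult_distrib)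
  qed
  then show ?thesis
    unfolding poly_even_poly_rev unfolding poly_even_poly sum_distrib_left
    by (intro sum.cong) (auto simp: mult.left_commute)
qed

text \<open>Only even powers occur, so all terms are nonnegative and the constant term
  \<open>u n\<close> is a positive lower bound.\<close>

lemma poly_even_poly_pos:
  assumes "\<And>j. j \<le> n \<Longrightarrow> u j > 0"
  shows "poly (even_poly n u) z > 0"
proof -
  have "u n * z ^ (2 * (n - n)) \<le> (\<Sum>j\<le>n. u j * z ^ (2 * (n - j)))"
    by (rule member_le_sum) (use assms in \<open>auto intro!: mult_nonneg_nonneg simp: less_imp_le\<close>)
  then show ?thesis using assms[of n] by (simp add: poly_even_poly)
qed

section \<open>Expansion of the folded numerator\<close>

text \<open>Identifies the \<open>c_coeff p a b j\<close> as the coefficients, in powers of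
  \<open>z\<^sup>2\<close>, of the product of \<open>P\<close> with the reversed
  \<open>Q\<close>.\<close>

lemma sum_c_coeff:
  assumes "p \<ge> 1"
  shows "(\<Sum>j<2 * p. c_coeff p a b j * z ^ (2 * j)) =
    poly (even_poly (p - 1) b) z * poly (even_poly p (\<lambda>j. a (p - j))) z"
proof -
  \<comment> \<open>For fixed \<open>k\<close> the zero-extended row is \<open>P\<close> shifted by
    \<open>z ^ (2 * k)\<close>; the bound \<open>k \<le> p\<close> keeps the support
    \<open>{k..p - 1 + k}\<close> below \<open>2 * p\<close>.\<close>
  have inner: "(\<Sum>j<2 * p. zero_ext (p - 1) b (int p - 1 - int j + int k) * z ^ (2 * j)) =
      (\<Sum>l\<le>p - 1. b l * z ^ (2 * (p - 1 - l))) * z ^ (2 * k)" if "k \<le> p" for k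
  proof -
    have "(\<Sum>j<2 * p. zero_ext (p - 1) b (int p - 1 - int j + int k) * z ^ (2 * j)) =
      (\<Sum>j=k..p - 1 + k. b (p - 1 + k - j) * z ^ (2 * j))"
      using that assms
      by (intro sum.mono_neutral_cong_right) (auto simp: zero_ext_def nat_diff_distrib nat_add_distrib of_nat_diff intro!: arg_cong[of _ _ b])
    also have "\<dots> = (\<Sum>l\<le>p - 1. b l * z ^ (2 * (p - 1 - l + k)))"
    proof -
      have "p - 1 - (p - 1 + k - j) + k = j" if "k \<le> j" "j \<le> p - 1 + k" for j
        using that by linarith
      then show ?thesis
        by (intro sum.reindex_bij_witness[of _ "\<lambda>l. p - 1 + k - l" "\<lambda>j. p - 1 + k - j"])
          (auto simp del: distrib_left_numeral)
    qed
    finally show ?thesis by (simp add: sum_distrib_right power_add mult.assoc)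
  qed
  have "(\<Sum>j<2 * p. c_coeff p a b j * z ^ (2 * j)) = (\<Sum>k=0..2 * p - 1. zero_ext p a (int k) *
      (\<Sum>j<2 * p. zero_ext (p - 1) b (int p - 1 - int j + int k) * z ^ (2 * j)))"
    unfolding c_coeff_def sum_distrib_right sum_distrib_left
    by (subst sum.swap) (simp add: mult.assoc)
  also have "\<dots> = (\<Sum>k\<le>p. a k *
      (\<Sum>j<2 * p. zero_ext (p - 1) b (int p - 1 - int j + int k) * z ^ (2 * j)))"
    using assms by (intro sum.mono_neutral_cong_right) (auto simp: zero_ext_def)
  also have "\<dots> = (\<Sum>k\<le>p. a k * ((\<Sum>l\<le>p - 1. b l * z ^ (2 * (p - 1 - l))) * z ^ (2 * k)))"
    by (intro sum.cong refl) (simp only: inner atMost_iff)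
  finally show ?thesis
    unfolding poly_even_poly_rev unfolding poly_even_poly
    by (simp add: sum_distrib_left mult.left_commute)
qed

text \<open>The second product is the reversal of the first, so the coefficients \<open>s j\<close>
  of the sum are palindromic. Pairing \<open>j\<close> with \<open>2 * p - 1 - j\<close> leaves odd
  power sums in \<open>z\<close> and \<open>v\<close>, which \<open>Chebyshev_sums\<close> expands
  in powers of \<open>(v - z)\<^sup>2\<close>.\<close>

lemma numerator_expansion:
  fixes z v :: real
  assumes p: "p \<ge> 1" and zv: "z * v = 1"
  shows "v ^ (2 * (p - 1)) *
     (poly (even_poly (p - 1) b) z * poly (even_poly p (\<lambda>j. a (p - j))) z +
      poly (even_poly (p - 1) (\<lambda>j. b (p - 1 - j))) z * poly (even_poly p a) z) =
     z * (z + v) * (\<Sum>i\<le>p - 1. (\<Sum>k=0..p - 1 - i. (c_coeff p a b k + c_coeff p a b (2 * p - 1 - k)) *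
        real ((p - 1 - k + i) choose (2 * i))) * ((v - z)\<^sup>2) ^ i)"
    (is "_ * (?A + ?B) = _")
proof -
  define c where "c = c_coeff p a b"
  define s where "s k = c k + c (2 * p - 1 - k)" for k
  have vz: "v ^ n * z ^ n = 1" for n
    using zv by (simp add: mult.commute flip: power_mult_distrib)
  have A: "v ^ (2 * (p - 1)) * ?A = (\<Sum>j<2 * p. c j * z ^ (2 * j) * v ^ (2 * (p - 1)))"
    unfolding sum_c_coeff[OF p, symmetric] c_def by (simp add: sum_distrib_left mult.commute)
  have "?B = z ^ (2 * (p - 1)) * poly (even_poly (p - 1) b) v *
      (z ^ (2 * p) * poly (even_poly p (\<lambda>j. a (p - j))) v)"
  proof -
    have "poly (even_poly p a) z = z ^ (2 * p) * poly (even_poly p (\<lambda>j. a (p - j))) v"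
      unfolding poly_even_poly_inverse[OF zv, symmetric]
      using vz[of "2 * p"] by (metis mult.assoc mult.commute mult_1)
    moreover have "poly (even_poly (p - 1) (\<lambda>j. b (p - 1 - j))) z =
        z ^ (2 * (p - 1)) * poly (even_poly (p - 1) b) v"
      using poly_even_poly_inverse[of v z "p - 1" b] zv by (simp add: mult.commute)
    ultimately show ?thesis by simp
  qed
  then have "v ^ (2 * (p - 1)) * ?B = z ^ (2 * p) * (\<Sum>j<2 * p. c j * v ^ (2 * j))"
    unfolding sum_c_coeff[OF p, symmetric] c_def using vz[of "2 * (p - 1)"]
    by (simp add: sum_c_coeff[OF p])
  also have "\<dots> = (\<Sum>j<2 * p. c (2 * p - 1 - j) * v ^ (2 * (2 * p - 1 - j)) * z ^ (2 * p))"
    unfolding sum_distrib_left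
    by (rule sum.reindex_bij_witness[of _ "\<lambda>j. 2 * p - 1 - j" "\<lambda>j. 2 * p - 1 - j"]) auto
  also have "\<dots> = (\<Sum>j<2 * p. c (2 * p - 1 - j) * z ^ (2 * j) * v ^ (2 * (p - 1)))"
  proof (intro sum.cong refl)
    fix j assume "j \<in> {..<2 * p}"
    then have "2 * p - 1 - j + j = p - 1 + p" using p by simp
    then have "2 * (2 * p - 1 - j) + 2 * j = 2 * (p - 1) + 2 * p" by linarith
    then have "v ^ (2 * (2 * p - 1 - j)) * v ^ (2 * j) = v ^ (2 * (p - 1)) * v ^ (2 * p)"
      by (metis power_add)
    then have "v ^ (2 * (2 * p - 1 - j)) * (v ^ (2 * j) * z ^ (2 * j)) * z ^ (2 * p) =
        v ^ (2 * (p - 1)) * (v ^ (2 * p) * z ^ (2 * p)) * z ^ (2 * j)"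
      by (simp add: mult.assoc[symmetric])
    then show "c (2 * p - 1 - j) * v ^ (2 * (2 * p - 1 - j)) * z ^ (2 * p) =
        c (2 * p - 1 - j) * z ^ (2 * j) * v ^ (2 * (p - 1))"
      unfolding vz by (simp add: mult_ac)
  qed
  finally have "v ^ (2 * (p - 1)) * (?A + ?B) = (\<Sum>j<2 * p. s j * z ^ (2 * j) * v ^ (2 * (p - 1)))"
    unfolding distrib_left A by (simp add: s_def algebra_simps flip: sum.distrib)
  \<comment> \<open>The range is cut at its midpoint, and the upper half is mirrored onto the lower
    by the symmetry of \<open>s\<close>.\<close>
  also have "\<dots> = (\<Sum>j<p. s j * z ^ (2 * j) * v ^ (2 * (p - 1))) +
      (\<Sum>j=p..<2 * p. s j * z ^ (2 * j) * v ^ (2 * (p - 1)))"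
    by (subst sum.union_disjoint[symmetric]) (auto intro!: sum.cong)
  also have "(\<Sum>j=p..<2 * p. s j * z ^ (2 * j) * v ^ (2 * (p - 1))) =
      (\<Sum>j<p. s j * z ^ (2 * (2 * p - 1 - j)) * v ^ (2 * (p - 1)))"
    by (rule sum.reindex_bij_witness[of _ "\<lambda>j. 2 * p - 1 - j" "\<lambda>j. 2 * p - 1 - j"])
      (auto simp: s_def)
  also have "(\<Sum>j<p. s j * z ^ (2 * j) * v ^ (2 * (p - 1))) + \<dots> =
      (\<Sum>j<p. s j * (z * (z ^ (2 * (p - 1 - j) + 1) + v ^ (2 * (p - 1 - j) + 1))))"
    unfolding sum.distrib[symmetric]
  proof (intro sum.cong refl)
    fix j assume "j \<in> {..<p}"
    \<comment> \<open>With \<open>m = p - 1 - j\<close> the two paired terms are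
      \<open>v ^ (2 * m)\<close> and \<open>z ^ (2 * m + 2)\<close>; extracting one factor
      \<open>z\<close> makes them symmetric.\<close>
    then obtain m where m: "p = Suc (j + m)" by (metis lessThan_iff less_imp_Suc_add)
    have e: "2 * (2 * p - 1 - j) = 2 * (p - 1) + (2 * m + 2)" "2 * (p - 1) = 2 * j + 2 * m"
      "p - 1 - j = m" using m by auto
    have "z ^ (2 * j) * v ^ (2 * (p - 1)) = v ^ (2 * m)"
      unfolding e(2) power_add using vz[of "2 * j"] by (simp add: mult_ac)
    moreover have "z ^ (2 * (2 * p - 1 - j)) * v ^ (2 * (p - 1)) = z ^ (2 * m + 2)"
      unfolding e(1) power_add[of z "2 * (p - 1)"] using vz[of "2 * (p - 1)"] by (simp add: mult_ac)
    moreover have "z * v ^ (2 * m + 1) = v ^ (2 * m)" using zv by (simp add: mult_ac)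
    ultimately show "s j * z ^ (2 * j) * v ^ (2 * (p - 1)) +
        s j * z ^ (2 * (2 * p - 1 - j)) * v ^ (2 * (p - 1)) =
        s j * (z * (z ^ (2 * (p - 1 - j) + 1) + v ^ (2 * (p - 1 - j) + 1)))"
      unfolding e(3) by (simp add: algebra_simps)
  qed
  also have "\<dots> = (\<Sum>j<p. s j * (z * ((z + v) *
      (\<Sum>i\<le>p - 1. real ((p - 1 - j + i) choose (2 * i)) * ((v - z)\<^sup>2) ^ i))))"
    by (intro sum.cong refl, subst conjunct1[OF Chebyshev_sums[OF zv]]) auto
  also have "\<dots> = z * (z + v) * (\<Sum>j<p. \<Sum>i\<le>p - 1. s j * real ((p - 1 - j + i) choose (2 * i)) * ((v - z)\<^sup>2) ^ i)"
    by (simp add: sum_distrib_left mult_ac)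
  also have "\<dots> = z * (z + v) * (\<Sum>i\<le>p - 1. \<Sum>j<p. s j * real ((p - 1 - j + i) choose (2 * i)) * ((v - z)\<^sup>2) ^ i)"
    by (subst sum.swap) simp
  \<comment> \<open>For \<open>k > p - 1 - i\<close> the binomial is zero, since
    \<open>p - 1 - k + i < 2 * i\<close>.\<close>
  also have "\<dots> = z * (z + v) * (\<Sum>i\<le>p - 1. (\<Sum>k=0..p - 1 - i. s k *
      real ((p - 1 - k + i) choose (2 * i))) * ((v - z)\<^sup>2) ^ i)"
    unfolding sum_distrib_right using p
    by (intro arg_cong[of _ _ "\<lambda>t. z * (z + v) * t"] sum.cong refl sum.mono_neutral_right)
      (auto simp: binomial_eq_0)
  finally show ?thesis unfolding s_def c_def .
qed

section \<open>Expansion of the folded denominator\<close>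

text \<open>Pascal's rule splits the first binomial, and absorption gives \<open>2 * i * (n choose
  (2 * i)) = (m - i) * (n choose (2 * i - 1))\<close> for \<open>n = m + i - 1\<close>. The
  right-hand side is the weight in \<open>alpha\<close>.\<close>

lemma binomial_add_absorb:
  assumes "i \<ge> 1" "i \<le> m"
  shows "real ((m + i) choose (2 * i)) + real ((m - 1 + i) choose (2 * i)) =
    real m / real i * real ((m + i - 1) choose (m - i))"
proof -
  define n where "n = m + i - 1"
  have n: "m + i = Suc n" "m - 1 + i = n" "2 * i = Suc (2 * i - 1)"
    using assms by (auto simp: n_def)
  have sym: "n choose (m - i) = n choose (2 * i - 1)"
    using assms by (subst binomial_symmetric) (auto simp: n_def)
  have "2 * i * (n choose (2 * i)) = (m - i) * (n choose (2 * i - 1))"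
    using binomial_absorption[of "2 * i - 1" n] binomial_absorb_comp[of n "2 * i - 1"] assms
    by (simp add: n_def)
  then have "real (2 * i) * real (n choose (2 * i)) = (real m - real i) * real (n choose (2 * i - 1))"
    using assms by (metis of_nat_mult of_nat_diff)
  moreover have "(m + i) choose (2 * i) = (n choose (2 * i - 1)) + (n choose (2 * i))"
    unfolding n(1) using binomial_Suc_Suc[of n "2 * i - 1"] unfolding n(3)[symmetric] .
  ultimately show ?thesis
    using assms unfolding n(2) n_def[symmetric] sym by (simp add: field_simps)
qed

text \<open>Substituting \<open>m = k + i - 1\<close> and extending the range down to 1, where both
  binomials vanish for \<open>m < i\<close>, gives a range independent of \<open>i\<close>, ready
  for an exchange of sums.\<close>

lemma alpha_eq:
  assumes "i \<ge> 1" "i \<le> p"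
  shows "2 * alpha p a i / 4 ^ i = (\<Sum>m=1..p. d_coeff p a (m + 1) *
     (real ((m + i) choose (2 * i)) + real ((m - 1 + i) choose (2 * i))))"
proof -
  have "2 * 2 ^ (2 * i - 1) = (4 :: real) ^ i"
    using assms by (simp add: power_mult flip: power_Suc)
  then have "2 * alpha p a i / 4 ^ i = (\<Sum>k=1..p + 1 - i. (real k + real i - 1) / real i *
            real ((k + 2 * i - 2) choose (k - 1)) * d_coeff p a (k + i))"
    using assms by (simp add: alpha_def field_simps)
  also have "\<dots> = (\<Sum>m=i..p. d_coeff p a (m + 1) *
      (real m / real i * real ((m + i - 1) choose (m - i))))"
  proof (rule sum.reindex_bij_witness[of _ "\<lambda>m. m + 1 - i" "\<lambda>k. k + i - 1"], goal_cases)
    case (5 k)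
    then have e: "k + i - 1 + i - 1 = k + 2 * i - 2" "k + i - 1 - i = k - 1" "k + i - 1 + 1 = k + i"
      "real (k + i - 1) = real k + real i - 1" by auto
    show ?case unfolding e by simp
  qed (use assms in auto)
  also have "\<dots> = (\<Sum>m=i..p. d_coeff p a (m + 1) *
     (real ((m + i) choose (2 * i)) + real ((m - 1 + i) choose (2 * i))))"
    by (intro sum.cong refl, subst binomial_add_absorb) (use assms in auto)
  also have "\<dots> = (\<Sum>m=1..p. d_coeff p a (m + 1) *
     (real ((m + i) choose (2 * i)) + real ((m - 1 + i) choose (2 * i))))"
    using assms by (intro sum.mono_neutral_left) (auto simp: binomial_eq_0)
  finally show ?thesis .
qed

text \<open>Multiplied by \<open>z + v\<close>, the even power sum of index \<open>m\<close> becomes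
  the sum of the odd ones for \<open>m\<close> and \<open>m - 1\<close>. The factor cancels, as
  \<open>z + v = 0\<close> would give \<open>- (z\<^sup>2) = 1\<close>.\<close>

lemma power_sum_expansion:
  fixes z v :: real
  assumes "z * v = 1" "1 \<le> m" "m \<le> p"
  shows "z ^ (2 * m) + v ^ (2 * m) =
    (\<Sum>i\<le>p. (real ((m + i) choose (2 * i)) + real ((m - 1 + i) choose (2 * i))) * ((v - z)\<^sup>2) ^ i)"
    (is "_ = ?R")
proof -
  obtain n where n: "m = Suc n" using assms by (cases m) auto
  have "z ^ (2 * n + 1) = v * z ^ (2 * m)" "v ^ (2 * n + 1) = z * v ^ (2 * m)"
    using assms(1) by (simp_all add: n mult_ac)
  then have "(z + v) * (\<Sum>i\<le>p. real ((n + i) choose (2 * i)) * ((v - z)\<^sup>2) ^ i) =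
      v * z ^ (2 * m) + z * v ^ (2 * m)"
    using conjunct1[OF Chebyshev_sums[OF assms(1), of n p]] assms(3) n by (metis Suc_leD)
  moreover have "(z + v) * (\<Sum>i\<le>p. real ((m + i) choose (2 * i)) * ((v - z)\<^sup>2) ^ i) =
      z ^ (2 * m + 1) + v ^ (2 * m + 1)"
    using Chebyshev_sums[OF assms(1), of m p] assms by blast
  moreover have "m - 1 = n" using n by simp
  ultimately have "(z + v) * ?R =
      (z ^ (2 * m + 1) + v ^ (2 * m + 1)) + (v * z ^ (2 * m) + z * v ^ (2 * m))"
    by (simp only: distrib_right[of "real _"] sum.distrib distrib_left[of "z + v"])
  also have "(z ^ (2 * m + 1) + v ^ (2 * m + 1)) + (v * z ^ (2 * m) + z * v ^ (2 * m)) =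
      (z + v) * (z ^ (2 * m) + v ^ (2 * m))"
    by (simp add: algebra_simps)
  finally have "(z + v) * ?R = (z + v) * (z ^ (2 * m) + v ^ (2 * m))" .
  moreover have "z + v \<noteq> 0"
  proof
    assume "z + v = 0"
    then have "- (z\<^sup>2) = 1" using assms(1) by (simp add: eq_neg_iff_add_eq_0[symmetric] power2_eq_square)
    then show False using zero_le_power2[of z] by linarith
  qed
  ultimately show ?thesis by simp
qed

text \<open>By reversal the left side is a double sum of
  \<open>a j * a k * v ^ (2 * j) * z ^ (2 * k)\<close>. Its main diagonal is twice
  \<open>d_coeff p a 1\<close>, and the pairs at distance \<open>m\<close> give
  \<open>d_coeff p a (m + 1)\<close> times an even power sum.\<close>

lemma denominator_expansion:
  fixes z v :: real
  assumes p: "p \<ge> 1" and zv: "z * v = 1" and a: "a 0 = 1" "a p = 1"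
  shows "v ^ (2 * p) * (poly (even_poly p a) z * poly (even_poly p (\<lambda>j. a (p - j))) z) =
    (\<Sum>i\<le>p. 2 * alpha p a i / 4 ^ i * ((v - z)\<^sup>2) ^ i)" (is "?L = _")
proof -
  define x where "x = (v - z)\<^sup>2"
  define h where "h j k = a j * v ^ (2 * j) * (a k * z ^ (2 * k))" for j k
  have vz: "v ^ n * z ^ n = 1" for n
    using zv by (simp add: mult.commute flip: power_mult_distrib)
  have h: "h j (j + m) + h (j + m) j = a j * a (j + m) * (z ^ (2 * m) + v ^ (2 * m))" for j m
  proof -
    have "h j (j + m) + h (j + m) j =
        a j * a (j + m) * (v ^ (2 * j) * z ^ (2 * j)) * (z ^ (2 * m) + v ^ (2 * m))"
      by (simp add: h_def power_add algebra_simps)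
    then show ?thesis unfolding vz by simp
  qed
  have "?L = (\<Sum>j\<le>p. \<Sum>k\<le>p. h j k)"
    unfolding mult.assoc[symmetric] poly_even_poly_inverse[OF zv] unfolding poly_even_poly_rev h_def
    by (simp add: sum_product)
  also have "\<dots> = (\<Sum>j\<le>p. h j j) + (\<Sum>m=1..p. \<Sum>j\<le>p - m. h j (j + m) + h (j + m) j)"
    by (rule sum_square_diagonals)
  also have "(\<Sum>j\<le>p. h j j) = (\<Sum>j\<le>p. (a j)\<^sup>2)"
    unfolding h_def using vz by (intro sum.cong) (auto simp: power2_eq_square mult_ac)
  also have "\<dots> = 2 * d_coeff p a 1"
    by (simp add: d_coeff_def)
      (rule sum.reindex_bij_witness[of _ "\<lambda>j. p - j" "\<lambda>j. p - j"], auto)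
  also have "(\<Sum>m=1..p. \<Sum>j\<le>p - m. h j (j + m) + h (j + m) j) =
      (\<Sum>m=1..p. d_coeff p a (m + 1) * (z ^ (2 * m) + v ^ (2 * m)))"
  proof (intro sum.cong refl)
    fix m assume m: "m \<in> {1..p}"
    have "(\<Sum>j\<le>p - m. a j * a (j + m)) = d_coeff p a (m + 1)"
      using m unfolding d_coeff_def
      by simp (rule sum.reindex_bij_witness[of _ "\<lambda>j. p - m - j" "\<lambda>j. p - m - j"],
          auto simp: mult.commute add.commute)
    then show "(\<Sum>j\<le>p - m. h j (j + m) + h (j + m) j) =
        d_coeff p a (m + 1) * (z ^ (2 * m) + v ^ (2 * m))"
      unfolding h by (simp flip: sum_distrib_right)
  qed
  also have "\<dots> = (\<Sum>m=1..p. \<Sum>i\<le>p. d_coeff p a (m + 1) *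
      (real ((m + i) choose (2 * i)) + real ((m - 1 + i) choose (2 * i))) * x ^ i)"
    by (intro sum.cong refl)
      (use power_sum_expansion[OF zv, of _ p] in \<open>simp add: sum_distrib_left x_def mult.assoc\<close>)
  also have "\<dots> = (\<Sum>i\<le>p. (\<Sum>m=1..p. d_coeff p a (m + 1) *
      (real ((m + i) choose (2 * i)) + real ((m - 1 + i) choose (2 * i)))) * x ^ i)"
    unfolding sum_distrib_right by (rule sum.swap)
  \<comment> \<open>The term \<open>i = 0\<close> is separated because \<open>alpha_eq\<close>
    covers only \<open>i \<ge> 1\<close>; there both binomials are 1.\<close>
  also have "\<dots> = (\<Sum>m=1..p. d_coeff p a (m + 1) * 2) +
      (\<Sum>i=1..p. 2 * alpha p a i / 4 ^ i * x ^ i)"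
    using p by (simp add: atLeast0AtMost[symmetric] sum.atLeast_Suc_atMost[of 0] alpha_eq)
  also have "2 * d_coeff p a 1 + (\<dots>) = 2 * alpha p a 0 + (\<Sum>i=1..p. 2 * alpha p a i / 4 ^ i * x ^ i)"
  proof -
    \<comment> \<open>This is \<open>a p * a 0\<close>, the isolated summand 1 in
      \<open>alpha p a 0\<close>.\<close>
    have "d_coeff p a (p + 1) = 1" using p a by (simp add: d_coeff_def)
    then have "alpha p a 0 = (\<Sum>k=1..p + 1. d_coeff p a k)"
      by (simp add: alpha_def)
    also have "\<dots> = d_coeff p a 1 + (\<Sum>m=1..p. d_coeff p a (m + 1))"
      by (simp add: sum.atLeast_Suc_atMost[of 0] sum.shift_bounds_cl_Suc_ivl del: sum.cl_ivl_Suc)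
    finally show ?thesis by (simp add: sum_distrib_left mult.commute)
  qed
  also have "\<dots> = (\<Sum>i\<le>p. 2 * alpha p a i / 4 ^ i * x ^ i)"
    by (simp add: atLeast0AtMost[symmetric] sum.atLeast_Suc_atMost[of 0])
  finally show ?thesis unfolding x_def .
qed


section \<open>Rescaling to the transformed polynomials\<close>

text \<open>At \<open>z = v = 1\<close> the variable \<open>(v - z)\<^sup>2\<close> is zero, so only
  the constant term of the denominator expansion survives.\<close>

lemma even_poly_1_squared:
  assumes "p \<ge> 1" "a 0 = 1" "a p = 1"
  shows "(poly (even_poly p a) 1)\<^sup>2 = 2 * alpha p a 0"
proof -
  have "poly (even_poly p (\<lambda>j. a (p - j))) 1 = poly (even_poly p a) 1"
    using poly_even_poly_inverse[of 1 1 p a] by simp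
  moreover have "(\<Sum>i\<le>p. 2 * alpha p a i / 4 ^ i * 0 ^ i) = 2 * alpha p a 0"
    by (simp add: atLeast0AtMost[symmetric] sum.atLeast_Suc_atMost[of 0])
  ultimately show ?thesis
    using denominator_expansion[of p 1 1 a] assms by (simp add: power2_eq_square)
qed

lemma Q_plus_substitution:
  fixes u :: real
  assumes p: "p \<ge> 1" and a: "a 0 = 1" "a p = 1" and Q: "poly (even_poly p a) 1 > 0"
    and c: "c = poly (even_poly p a) 1 powr (1 / real p)" and u: "u > 0"
  shows "u ^ (2 * p) * poly (even_poly p (a_plus p a)) (c / u) =
    (\<Sum>i\<le>p. 2 * alpha p a i / 4 ^ i * (u\<^sup>2) ^ i)"
proof -
  define q where "q = poly (even_poly p a) 1"
  have q: "q > 0" using Q by (simp add: q_def)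
  have c0: "c > 0" using q by (simp add: c q_def)
  have cpow: "c ^ n = q powr (real n / real p)" for n
    using c0 by (simp add: c q_def powr_powr flip: powr_realpow)
  have c2p: "c ^ (2 * p) = q\<^sup>2"
    using p q by (simp add: cpow powr_numeral)
  \<comment> \<open>One formula for all indices: the prescribed end values 1 fit it because
    \<open>q\<^sup>2 = 2 * alpha p a 0\<close> and
    \<open>alpha p a p = 2 ^ (2 * p - 1)\<close>.\<close>
  have a_plus: "a_plus p a i = 2 * alpha p a i / 4 ^ i * c ^ (2 * i) / q\<^sup>2" if "i \<le> p" for i
  proof -
    have two: "2 * 2 ^ (2 * i - 1) = (4 :: real) ^ i" if "i \<ge> 1" for i
      using that by (simp add: power_mult flip: power_Suc)
    consider "i = 0" | "i = p" | "i \<noteq> 0" "i \<noteq> p" by blast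
    then show ?thesis
    proof cases
      case 1
      then show ?thesis
        using even_poly_1_squared[of p a, symmetric] p a q by (simp add: a_plus_def q_def)
    next
      case 2
      have "alpha p a p = 2 ^ (2 * p - 1)"
        using p a by (simp add: alpha_def d_coeff_def)
      then show ?thesis using 2 two[OF p] c2p q by (simp add: a_plus_def)
    next
      case 3
      have "q powr (2 * (1 - real i / real p)) = q powr (2 - real (2 * i) / real p)"
        by (simp add: algebra_simps)
      also have "\<dots> = q\<^sup>2 / c ^ (2 * i)"
        unfolding cpow powr_diff using q by (simp add: powr_numeral)
      finally show ?thesis
        using 3 two[of i] q c0 by (simp add: a_plus_def q_def field_simps)
    qed
  qed
  have "u ^ (2 * p) * (a_plus p a i * (c / u) ^ (2 * (p - i))) =
      2 * alpha p a i / 4 ^ i * (u\<^sup>2) ^ i" if "i \<le> p" for i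
  proof -
    have "2 * p = 2 * i + 2 * (p - i)" using that by simp
    then have "u ^ (2 * p) = u ^ (2 * i) * u ^ (2 * (p - i))" "c ^ (2 * i) * c ^ (2 * (p - i)) = q\<^sup>2"
      using c2p by (metis power_add)+
    moreover have "u ^ (2 * i) * u ^ (2 * (p - i)) *
        (2 * alpha p a i / 4 ^ i * c ^ (2 * i) / q\<^sup>2 * (c ^ (2 * (p - i)) / u ^ (2 * (p - i)))) =
        2 * alpha p a i / 4 ^ i * u ^ (2 * i) * ((c ^ (2 * i) * c ^ (2 * (p - i))) / q\<^sup>2)"
      using u by simp
    ultimately show ?thesis
      using q by (simp add: a_plus[OF that] power_divide power_mult)
  qed
  then show ?thesis
    unfolding poly_even_poly sum_distrib_left by (intro sum.cong) auto
qed

text \<open>The extra factor \<open>c\<close>, which comes from the derivative of the substitution,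
  completes the exponents \<open>1 + (2 * i + 1) + 2 * (p - 1 - i)\<close> to \<open>2 * p\<close>,
  so that all powers of \<open>c\<close> cancel against \<open>q\<^sup>2\<close>.\<close>

lemma P_plus_substitution:
  fixes u :: real
  assumes p: "p \<ge> 1" and Q: "poly (even_poly p a) 1 > 0"
    and c: "c = poly (even_poly p a) 1 powr (1 / real p)" and u: "u > 0"
  shows "c * u ^ (2 * (p - 1)) * poly (even_poly (p - 1) (b_plus p a b)) (c / u) =
    (\<Sum>i\<le>p - 1. (\<Sum>k=0..p - 1 - i. (c_coeff p a b k + c_coeff p a b (2 * p - 1 - k)) *
        real ((p - 1 - k + i) choose (2 * i))) * (u\<^sup>2) ^ i)"
proof -
  define q where "q = poly (even_poly p a) 1"
  define T where "T i = (\<Sum>k=0..p - 1 - i. (c_coeff p a b k + c_coeff p a b (2 * p - 1 - k)) *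
        real ((p - 1 - k + i) choose (2 * i)))" for i
  have q: "q > 0" using Q by (simp add: q_def)
  have c0: "c > 0" using q by (simp add: c q_def)
  have cpow: "c ^ n = q powr (real n / real p)" for n
    using c0 by (simp add: c q_def powr_powr flip: powr_realpow)
  have c2p: "c ^ (2 * p) = q\<^sup>2"
    using p q by (simp add: cpow powr_numeral)
  have b_plus: "b_plus p a b i = c ^ (2 * i + 1) / q\<^sup>2 * T i" for i
  proof -
    have "q powr (2 * real i / real p + 1 / real p - 2) = c ^ (2 * i + 1) / q\<^sup>2"
      unfolding cpow powr_diff using q by (simp add: powr_numeral add_divide_distrib add.commute)
    then show ?thesis by (simp add: b_plus_def T_def q_def)
  qed
  have "c * u ^ (2 * (p - 1)) * (b_plus p a b i * (c / u) ^ (2 * (p - 1 - i))) =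
      T i * (u\<^sup>2) ^ i" if "i \<le> p - 1" for i
  proof -
    have "2 * (p - 1) = 2 * i + 2 * (p - 1 - i)" "2 * p = 1 + (2 * i + 1) + 2 * (p - 1 - i)"
      using that p by simp_all
    then have "u ^ (2 * (p - 1)) = u ^ (2 * i) * u ^ (2 * (p - 1 - i))"
      "c * c ^ (2 * i + 1) * c ^ (2 * (p - 1 - i)) = q\<^sup>2"
      using c2p by (metis power_add power_one_right)+
    moreover have "c * (u ^ (2 * i) * u ^ (2 * (p - 1 - i))) *
        (c ^ (2 * i + 1) / q\<^sup>2 * T i * (c ^ (2 * (p - 1 - i)) / u ^ (2 * (p - 1 - i)))) =
        T i * u ^ (2 * i) * ((c * c ^ (2 * i + 1) * c ^ (2 * (p - 1 - i))) / q\<^sup>2)"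
      using u by simp
    ultimately show ?thesis
      using q by (simp add: b_plus power_divide power_mult)
  qed
  then show ?thesis
    unfolding poly_even_poly sum_distrib_left T_def[symmetric] by (intro sum.cong) auto
qed

section \<open>Both integrals as one integral over the unit interval\<close>

theorem theorem5p1:
  fixes p :: nat and a b :: "nat \<Rightarrow> real" and P Q P_plus Q_plus :: "real poly"
  assumes "p \<ge> 1"
    and "\<And>j. j \<le> p \<Longrightarrow> a j > 0"
    and "\<And>j. j \<le> p - 1 \<Longrightarrow> b j > 0"
    and "a 0 = 1" and "a p = 1"
    and "P = even_poly (p - 1) b"
    and "Q = even_poly p a"
    and "P_plus = even_poly (p - 1) (b_plus p a b)"
    and "Q_plus = even_poly p (a_plus p a)"
  shows "(\<lambda>z. poly P z / poly Q z) integrable_on {0..} \<and>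
         (\<lambda>z. poly P_plus z / poly Q_plus z) integrable_on {0..} \<and>
         integral {0..} (\<lambda>z. poly P z / poly Q z) =
           integral {0..} (\<lambda>z. poly P_plus z / poly Q_plus z)"
proof -
  define P' where "P' = even_poly (p - 1) (\<lambda>j. b (p - 1 - j))"
  define Q' where "Q' = even_poly p (\<lambda>j. a (p - j))"
  define F where "F z = poly P z / poly Q z + poly P' z / poly Q' z" for z
  define c where "c = poly Q 1 powr (1 / real p)"
  have Q: "poly Q z > 0" for z
    unfolding assms by (rule poly_even_poly_pos) (use assms in auto)
  have Q': "poly Q' z > 0" for z
    unfolding Q'_def by (rule poly_even_poly_pos) (use assms in auto)
  have c: "c > 0" using Q[of 1] by (simp add: c_def)
  have contQ: "continuous_on {0..1} (\<lambda>z. poly P z / poly Q z)"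
    using Q by (intro continuous_intros) (metis less_irrefl)
  have contQ': "continuous_on {0..1} (\<lambda>z. poly P' z / poly Q' z)"
    using Q' by (intro continuous_intros) (metis less_irrefl)
  have "((\<lambda>z. poly P z / poly Q z) has_integral integral {0..1} F) {0..}"
    unfolding F_def
  proof (rule has_integral_fold[OF contQ contQ'])
    fix z :: real assume z: "0 < z" "z \<le> 1"
    \<comment> \<open>The degree gap of 2 between \<open>P\<close> and \<open>Q\<close> supplies the
      Jacobian \<open>1 / z\<^sup>2\<close>.\<close>
    have "z ^ (2 * p) = z\<^sup>2 * z ^ (2 * (p - 1))"
      using assms(1) by (cases p) (simp_all add: power2_eq_square)
    moreover have "poly P' z = z ^ (2 * (p - 1)) * poly P (1 / z)"
      "poly Q' z = z ^ (2 * p) * poly Q (1 / z)"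
      unfolding P'_def Q'_def assms
      by (rule poly_even_poly_inverse[symmetric], use z in simp)+
    ultimately show "poly P' z / poly Q' z = poly P (1 / z) / poly Q (1 / z) / z\<^sup>2"
      using z by simp
  qed
  moreover have "((\<lambda>z. poly P_plus z / poly Q_plus z) has_integral integral {0..1} F) {0..}"
  proof (rule has_integral_Landen_substitution[OF c])
    show "continuous_on {0..1} F"
      unfolding F_def by (intro continuous_on_add contQ contQ')
    fix z :: real assume z: "0 < z" "z < 1"
    define v where "v = 1 / z"
    define u where "u = v - z"
    define N where "N = poly P z * poly Q' z + poly P' z * poly Q z"
    have zv: "z * v = 1" and v: "v > 0" using z by (simp_all add: v_def)
    have "v > 1" using z by (simp add: v_def)
    then have u: "u > 0" using z by (simp add: u_def)
    have N: "c * u ^ (2 * (p - 1)) * poly P_plus (c / u) * (z * (z + v)) = v ^ (2 * (p - 1)) * N"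
      using P_plus_substitution[of p a c u b] numerator_expansion[of p z v b a] assms Q[of 1] u zv
      by (simp add: c_def u_def N_def P'_def Q'_def)
    have D: "u ^ (2 * p) * poly Q_plus (c / u) = v ^ (2 * p) * (poly Q z * poly Q' z)"
      using Q_plus_substitution[of p a c u] denominator_expansion[of p z v a] assms Q[of 1] u zv
      by (simp add: c_def u_def Q'_def)
    \<comment> \<open>Nonvanishing is read off from \<open>D\<close>, whose right-hand side is
      positive.\<close>
    have Qp: "poly Q_plus (c / u) \<noteq> 0"
      using D u v Q[of z] Q'[of z] by (metis less_irrefl mult_eq_0_iff power_eq_0_iff)
    have e: "w ^ (2 * p) = w\<^sup>2 * w ^ (2 * (p - 1))" for w :: real
      using assms(1) by (cases p) (simp_all add: power2_eq_square)
    define K where "K = v ^ (2 * (p - 1))"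
    define U where "U = u ^ (2 * (p - 1))"
    have KU: "K > 0" "U > 0" using u v by (simp_all add: K_def U_def)
    have N': "N = c * U * poly P_plus (c / u) * (z * (z + v)) / K"
      using N[folded K_def U_def] KU by (simp add: field_simps)
    have D': "poly Q z * poly Q' z = u\<^sup>2 * U * poly Q_plus (c / u) / (v\<^sup>2 * K)"
      using D[unfolded e, folded K_def U_def] KU v by (simp add: field_simps)
    have "F z = N / (poly Q z * poly Q' z)"
      using Q[of z] Q'[of z] by (simp add: F_def N_def add_frac_eq)
    \<comment> \<open>After \<open>K\<close> and \<open>U\<close> cancel, the remaining factor is
      exactly the derivative of the Landen substitution.\<close>
    also have "\<dots> = c * (v * (z * v) * (z + v)) / u\<^sup>2 * (poly P_plus (c / u) / poly Q_plus (c / u))"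
      unfolding N' D' using KU v u Qp by (simp add: divide_simps power2_eq_square)
    also have "v * (z * v) * (z + v) = 1 + 1 / z\<^sup>2"
      using zv by (simp add: v_def power2_eq_square algebra_simps)
    finally show "F z = c * (1 + 1 / z\<^sup>2) / (1 / z - z)\<^sup>2 *
        (poly P_plus (c / (1 / z - z)) / poly Q_plus (c / (1 / z - z)))"
      by (simp add: u_def v_def)
  qed
  ultimately show ?thesis
    by (auto simp: has_integral_iff)
qed

end
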